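(* For every number of nodes $s$ ($s \ge 1$ for Radau, $s \ge 2$ for Lobatto), the Runge-Kutta method induced by the SBP SAT scheme using left Radau quadrature is the classical $s$-stage Radau IA method, the one induced by the SBP SAT scheme using right Radau quadrature is the classical $s$-stage Radau IIA method, and the one induced by the SBP SAT scheme using Lobatto quadrature is the classical $s$-stage Lobatto IIIC method; that is, in each case the Butcher coefficients $(A,b,c)$ coincide.
   Context: Quadratures on $[0,1]$ with $s$ nodes $c_1<\dots<c_s$ and weights $b_1,\dots,b_s$: left Radau quadrature has $c_1 = 0$ and is exact for polynomials of degree $\le 2s-2$; right Radau quadrature has $c_s = 1$ and is exact for polynomials of degree $\le 2s-2$; Lobatto quadrature has $c_1=0$, $c_s=1$ and is exact for polynomials of degree $\le 2s-3$. SBP operators on these nodes. Let $T>0$ and $\tau_i = T c_i$. The SBP (summation by parts) operator on $[0,T]$ using the quadrature is given by: $D\in\mathbb{R}^{s\times s}$, the polynomial differentiation matrix (mapping the values at $\tau_1,\dots,\tau_s$ of any polynomial of degree $\le s-1$ to the values of its derivative there); $M = T\operatorname{diag}(b_1,\dots,b_s)$; and $t_L,t_R \in \mathbb{R}^s$, the vectors such that $t_L^T v = v(0)$ and $t_R^T v = v(T)$ for the nodal value vector of any polynomial $v$ of degree $\le s-1$. These satisfy $MD + D^TM = t_Rt_R^T - t_Lt_L^T$. It is known that for these operators and every $\sigma>\frac12$ all eigenvalues of $D+\sigma M^{-1}t_Lt_L^T$ have strictly positive real part; in particular $D + M^{-1}t_Lt_L^T$ is invertible. SBP SAT scheme. For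 $u'(t)=f(t,u(t))$, $u(0)=u_0$, the scheme is $Du = f + M^{-1}t_L(u_0 - t_L^Tu)$ with $u=(u_i)_i$, $f=(f(\tau_i,u_i))_i$, and numerical solution $t_R^Tu$ at time $T$. The induced Runge-Kutta method has Butcher coefficients $$A = \tfrac1T(D+M^{-1}t_Lt_L^T)^{-1},\quad b = \tfrac1T M\mathbf{1},\quad c=\tfrac1T(\tau_1,\dots,\tau_s)^T,$$ with $\mathbf{1}=(1,\dots,1)^T$. Simplifying conditions: $$C(\eta):\ \sum_{j=1}^s a_{i,j}c_j^{q-1} = \tfrac1q c_i^q,\quad i\in\{1,\dots,s\},\ q\in\{1,\dots,\eta\};$$ $$D(\zeta):\ \sum_{i=1}^s b_ic_i^{q-1}a_{i,j} = \tfrac1q b_j(1-c_j^q),\quad j\in\{1,\dots,s\},\ q\in\{1,\dots,\zeta\}.$$ Classical methods. The $s$-stage Radau IA method has the nodes $c$ and weights $b$ of left Radau quadrature and the matrix $A$ uniquely determined by $D(s)$. The $s$-stage Radau IIA method has the nodes and weights of right Radau quadrature and $A$ uniquely determined by $C(s)$. The $s$-stage Lobatto IIIC method has the nodes and weights of Lobatto quadrature and $A$ uniquely determined by $C(s-1)$ together with $a_{i,1}=b_1$ for all $i\in\{1,\dots,s\}$. *)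

theory Defs
  imports
    "HOL-Analysis.Henstock_Kurzweil_Integration"
    "HOL-Computational_Algebra.Polynomial"
    "Jordan_Normal_Form.Gauss_Jordan_Elimination"
begin

(* Vectors and matrices are those of Jordan_Normal_Form, so the indices 1, ..., s of the
   mathematical text are 0, ..., s - 1 here. *)

no_notation Finite_Cartesian_Product.vec_nth (infixl \<open>$\<close> 90)

definition quadrature_on_unit_interval :: "nat \<Rightarrow> real vec \<Rightarrow> real vec \<Rightarrow> bool" where
  "quadrature_on_unit_interval s c b \<longleftrightarrow>
     c \<in> carrier_vec s \<and> b \<in> carrier_vec s \<and>
     (\<forall>i<s. 0 \<le> c $ i \<and> c $ i \<le> 1) \<and>
     (\<forall>i j. i < j \<and> j < s \<longrightarrow> c $ i < c $ j)"

definition quadrature_exact :: "nat \<Rightarrow> real vec \<Rightarrow> real vec \<Rightarrow> nat \<Rightarrow> bool" where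
  "quadrature_exact s c b m \<longleftrightarrow>
     (\<forall>p :: real poly. degree p \<le> m \<longrightarrow>
        (\<Sum>i<s. b $ i * poly p (c $ i)) = integral {0..1} (poly p))"

(* The natural-number subtractions do not truncate for s \<ge> 1 (Radau) and s \<ge> 2 (Lobatto). *)

definition left_radau :: "nat \<Rightarrow> real vec \<Rightarrow> real vec \<Rightarrow> bool" where
  "left_radau s c b \<longleftrightarrow>
     quadrature_on_unit_interval s c b \<and> c $ 0 = 0 \<and> quadrature_exact s c b (2 * s - 2)"

definition right_radau :: "nat \<Rightarrow> real vec \<Rightarrow> real vec \<Rightarrow> bool" where
  "right_radau s c b \<longleftrightarrow>
     quadrature_on_unit_interval s c b \<and> c $ (s - 1) = 1 \<and> quadrature_exact s c b (2 * s - 2)"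

definition lobatto :: "nat \<Rightarrow> real vec \<Rightarrow> real vec \<Rightarrow> bool" where
  "lobatto s c b \<longleftrightarrow>
     quadrature_on_unit_interval s c b \<and> c $ 0 = 0 \<and> c $ (s - 1) = 1 \<and>
     quadrature_exact s c b (2 * s - 3)"

definition nodal_values :: "nat \<Rightarrow> real vec \<Rightarrow> real poly \<Rightarrow> real vec" where
  "nodal_values s \<tau> p = Matrix.vec s (\<lambda>i. poly p (\<tau> $ i))"

(* For s \<ge> 1 pairwise distinct nodes the following two descriptions determine a unique
   matrix and a unique vector, by Lagrange interpolation. *)

definition diff_matrix :: "nat \<Rightarrow> real vec \<Rightarrow> real mat" where
  "diff_matrix s \<tau> = (THE D. D \<in> carrier_mat s s \<and>
     (\<forall>p. degree p \<le> s - 1 \<longrightarrow> D *\<^sub>v nodal_values s \<tau> p = nodal_values s \<tau> (pderiv p)))"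

definition eval_vec :: "nat \<Rightarrow> real vec \<Rightarrow> real \<Rightarrow> real vec" where
  "eval_vec s \<tau> x = (THE t. t \<in> carrier_vec s \<and>
     (\<forall>p. degree p \<le> s - 1 \<longrightarrow> t \<bullet> nodal_values s \<tau> p = poly p x))"

definition outer_product :: "real vec \<Rightarrow> real vec \<Rightarrow> real mat" where
  "outer_product v w = Matrix.mat (dim_vec v) (dim_vec w) (\<lambda>(i, j). v $ i * w $ j)"

(* mat_inverse returns Some B exactly when B is the two-sided inverse of the square matrix A. *)
definition inv_mat :: "real mat \<Rightarrow> real mat" where
  "inv_mat A = the (mat_inverse A)"

(* A Butcher tableau (A, b, c). *)
type_synonym butcher = "real mat \<times> real vec \<times> real vec"

(* The vector for evaluation at the right end point T does not enter the Butcher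
   coefficients, so only the one for the left end point appears. *)
definition sbp_sat_rk :: "real \<Rightarrow> nat \<Rightarrow> real vec \<Rightarrow> real vec \<Rightarrow> butcher" where
  "sbp_sat_rk T s c b =
     (let \<tau> = T \<cdot>\<^sub>v c;
          D = diff_matrix s \<tau>;
          M = T \<cdot>\<^sub>m mat_diag s (\<lambda>i. b $ i);
          tL = eval_vec s \<tau> 0
      in ((1 / T) \<cdot>\<^sub>m inv_mat (D + inv_mat M * outer_product tL tL),
          (1 / T) \<cdot>\<^sub>v (M *\<^sub>v Matrix.vec s (\<lambda>_. 1)),
          (1 / T) \<cdot>\<^sub>v \<tau>))"

definition simplifying_C :: "nat \<Rightarrow> real mat \<Rightarrow> real vec \<Rightarrow> nat \<Rightarrow> bool" where
  "simplifying_C s A c \<eta> \<longleftrightarrow>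
     (\<forall>i<s. \<forall>q\<in>{1..\<eta>}. (\<Sum>j<s. A $$ (i, j) * c $ j ^ (q - 1)) = 1 / real q * c $ i ^ q)"

definition simplifying_D :: "nat \<Rightarrow> real mat \<Rightarrow> real vec \<Rightarrow> real vec \<Rightarrow> nat \<Rightarrow> bool" where
  "simplifying_D s A b c \<zeta> \<longleftrightarrow>
     (\<forall>j<s. \<forall>q\<in>{1..\<zeta>}.
        (\<Sum>i<s. b $ i * c $ i ^ (q - 1) * A $$ (i, j)) = 1 / real q * b $ j * (1 - c $ j ^ q))"

(* The classical methods as functions of the nodes c and the weights b of the respective
   quadrature; on these, the conditions
   determine A uniquely. *)

definition radau_IA :: "nat \<Rightarrow> real vec \<Rightarrow> real vec \<Rightarrow> butcher" where
  "radau_IA s c b = ((THE A. A \<in> carrier_mat s s \<and> simplifying_D s A b c s), b, c)"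

definition radau_IIA :: "nat \<Rightarrow> real vec \<Rightarrow> real vec \<Rightarrow> butcher" where
  "radau_IIA s c b = ((THE A. A \<in> carrier_mat s s \<and> simplifying_C s A c s), b, c)"

definition lobatto_IIIC :: "nat \<Rightarrow> real vec \<Rightarrow> real vec \<Rightarrow> butcher" where
  "lobatto_IIIC s c b =
     ((THE A. A \<in> carrier_mat s s \<and> simplifying_C s A c (s - 1) \<and>
        (\<forall>i<s. A $$ (i, 0) = b $ 0)), b, c)"

end

theory Submission
  imports Defs "Jordan_Normal_Form.Determinant"
    "HOL-Analysis.Equivalence_Lebesgue_Henstock_Integration"
begin

text \<open>
  Write \<open>e\<close> for the vector of evaluation at \<open>0\<close>. After rescaling to the unit interval, the matrix
  \<open>K = T (D + M\<^sup>-\<^sup>1 t\<^sub>L t\<^sub>L\<^sup>T)\<close> maps the nodal values of a polynomial \<open>p\<close> of degree less than \<open>s\<close> to the vector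
  with entries \<open>p'(c\<^sub>i) + e\<^sub>i p(0) / b\<^sub>i\<close>, and the Butcher matrix is \<open>A = K\<^sup>-\<^sup>1\<close>. The scaling by \<open>T\<close> disappears,
  and everything becomes a statement about polynomials on \<open>[0, 1]\<close>.

  The only analytic input is that exactness of the quadrature turns integration by parts into an
  identity between sums over the nodes (\<open>quadrature_sbp\<close>). Exactness of degree \<open>2s - 3\<close> covers products of
  polynomials of degree less than \<open>s\<close>; this yields, by an energy estimate, that \<open>K\<close> is invertible
  (\<open>sbp_sat_kernel_trivial\<close>). Exactness of degree \<open>2s - 2\<close> also admits one factor of degree \<open>s\<close>, which is the
  additional order that the Radau methods have over Lobatto IIIC.

  \<^item> \<open>C(q)\<close> for \<open>q < s\<close>: the polynomial \<open>x\<^sup>q / q\<close> vanishes at \<open>0\<close> and has derivative \<open>x\<^sup>q\<^sup>-\<^sup>1\<close>, so \<open>K\<close> maps the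
    nodal values of the former to those of the latter (\<open>sbp_sat_simplifying_C\<close>).
  \<^item> Lobatto: since \<open>c\<^sub>1 = 0\<close>, \<open>e\<close> is the first unit vector, and \<open>K 1 = e / b\<^sub>1\<close> says that the first column of
    \<open>A\<close> is constantly \<open>b\<^sub>1\<close>.
  \<^item> Right Radau: \<open>x\<^sup>s\<close> agrees on the nodes with \<open>x\<^sup>s - \<omega>\<close>, where \<open>\<omega>\<close> vanishes at all nodes. As \<open>\<omega>(1) = 0\<close>,
    integration by parts against polynomials of degree less than \<open>s\<close> shows \<open>b\<^sub>i \<omega>'(c\<^sub>i) + e\<^sub>i \<omega>(0) = 0\<close>, so the
    correction \<open>\<omega>\<close> is invisible to \<open>K\<close> and \<open>C(s)\<close> follows.
  \<^item> Left Radau: column \<open>k\<close> of \<open>A\<close> consists of the nodal values of a polynomial \<open>P\<^sub>k\<close> with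
    \<open>P\<^sub>k'(c\<^sub>i) + e\<^sub>i P\<^sub>k(0) / b\<^sub>i = \<delta>\<^sub>i\<^sub>k\<close>. Integration by parts against \<open>(1 - x\<^sup>q) / q\<close>, whose derivative is
    \<open>-x\<^sup>q\<^sup>-\<^sup>1\<close>, gives \<open>D(q)\<close> for all \<open>q \<le> s\<close>.

  That these conditions pin down \<open>A\<close> is the invertibility of the Vandermonde matrix, used in the form
  that weights on \<open>n\<close> distinct points are determined by their first \<open>n\<close> moments
  (\<open>moments_determine_weights\<close>). The weights \<open>b\<^sub>i\<close>, by which \<open>K\<close> and the conditions \<open>D(q)\<close> have to be divided,
  are nonzero, as the integral of a nonnegative polynomial that vanishes at all other nodes shows
  (\<open>weight_nonzero\<close>).
\<close>

no_notation Finite_Cartesian_Product.vec_nth (infixl \<open>$\<close> 90)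
no_notation inner (infix \<open>\<bullet>\<close> 70)
hide_const (open) Module.smult

section \<open>Lagrange interpolation\<close>

definition lagrange_basis :: "'a set \<Rightarrow> ('a \<Rightarrow> real) \<Rightarrow> 'a \<Rightarrow> real poly" where
  "lagrange_basis J x j = (\<Prod>k\<in>J - {j}. smult (1 / (x j - x k)) [:- x k, 1:])"

lemma poly_lagrange_basis:
  assumes "finite J" "inj_on x J" "i \<in> J" "j \<in> J"
  shows "poly (lagrange_basis J x j) (x i) = (if i = j then 1 else 0)"
proof (cases "i = j")
  case True
  have "x i - x k \<noteq> 0" if "k \<in> J - {i}" for k
    using that assms by (auto dest: inj_onD)
  then show ?thesis
    using True by (auto simp: lagrange_basis_def poly_prod divide_simps intro!: prod.neutral)
next
  case False
  then show ?thesis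
    using assms by (auto simp: lagrange_basis_def poly_prod intro!: prod_zero)
qed

lemma degree_lagrange_basis:
  assumes "finite J" "j \<in> J"
  shows "degree (lagrange_basis J x j) \<le> card J - 1"
proof -
  have "degree (lagrange_basis J x j)
      \<le> (\<Sum>k\<in>J - {j}. degree (smult (1 / (x j - x k)) [:- x k, 1:]))"
    unfolding lagrange_basis_def
    using degree_prod_sum_le[of "J - {j}" "\<lambda>k. smult (1 / (x j - x k)) [:- x k, 1:]"] assms
    by (simp only: o_def finite_Diff)
  also have "\<dots> \<le> (\<Sum>k\<in>J - {j}. 1)"
    by (rule sum_mono) auto
  finally show ?thesis
    using assms by simp
qed

text \<open>
  Equal moments up to \<open>card J - 1\<close> mean that both weight families give the same functional on
  polynomials of degree less than \<open>card J\<close>; applying it to the Lagrange basis reads off the weights.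
\<close>

lemma moments_determine_weights:
  fixes x u v :: "'a \<Rightarrow> real"
  assumes "finite J" "inj_on x J" "i \<in> J"
    and moments: "\<And>k. k < card J \<Longrightarrow> (\<Sum>j\<in>J. u j * x j ^ k) = (\<Sum>j\<in>J. v j * x j ^ k)"
  shows "u i = v i"
proof -
  let ?p = "lagrange_basis J x i"
  have expand: "(\<Sum>j\<in>J. w j * poly ?p (x j))
      = (\<Sum>k\<le>degree ?p. coeff ?p k * (\<Sum>j\<in>J. w j * x j ^ k))" for w
    unfolding poly_altdef sum_distrib_left by (subst sum.swap) (simp add: mult_ac)
  have "card J > 0"
    using assms by (auto simp: card_gt_0_iff)
  then have "k < card J" if "k \<le> degree ?p" for k
    using degree_lagrange_basis[OF assms(1,3), of x] that by linarith
  then have "(\<Sum>j\<in>J. u j * poly ?p (x j)) = (\<Sum>j\<in>J. v j * poly ?p (x j))"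
    unfolding expand by (intro sum.cong) (auto simp: moments)
  moreover have "(\<Sum>j\<in>J. w j * poly ?p (x j)) = w i" for w
  proof -
    have "(\<Sum>j\<in>J. w j * poly ?p (x j)) = (\<Sum>j\<in>J. if j = i then w j else 0)"
      using assms by (intro sum.cong) (auto simp: poly_lagrange_basis)
    then show ?thesis
      using assms by simp
  qed
  ultimately show ?thesis
    by simp
qed

definition interpolant :: "'a set \<Rightarrow> ('a \<Rightarrow> real) \<Rightarrow> ('a \<Rightarrow> real) \<Rightarrow> real poly" where
  "interpolant J x y = (\<Sum>j\<in>J. smult (y j) (lagrange_basis J x j))"

lemma poly_interpolant:
  assumes "finite J" "inj_on x J" "i \<in> J"
  shows "poly (interpolant J x y) (x i) = y i"
proof -
  have "poly (interpolant J x y) (x i) = (\<Sum>j\<in>J. if j = i then y j else 0)"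
    unfolding interpolant_def poly_sum poly_smult
    using assms by (intro sum.cong) (auto simp: poly_lagrange_basis)
  then show ?thesis
    using assms by simp
qed

lemma degree_interpolant:
  assumes "finite J"
  shows "degree (interpolant J x y) \<le> card J - 1"
  unfolding interpolant_def
  by (intro degree_sum_le[OF assms]) (metis degree_lagrange_basis[OF assms] degree_smult_le le_trans)

lemma poly_eq_on_nodes:
  fixes x :: "'a \<Rightarrow> real"
  assumes "finite J" "J \<noteq> {}" "inj_on x J" "degree p \<le> card J - 1" "degree q \<le> card J - 1"
    and eq: "\<And>j. j \<in> J \<Longrightarrow> poly p (x j) = poly q (x j)"
  shows "p = q"
proof -
  have "card (x ` J) = card J" "card J > 0"
    using assms by (auto simp: card_image card_gt_0_iff)
  then show ?thesis
    using assms by (intro poly_eqI_degree[of "x ` J"]) auto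
qed

lemma interpolant_poly:
  assumes "finite J" "J \<noteq> {}" "inj_on x J" "degree p \<le> card J - 1"
  shows "interpolant J x (\<lambda>j. poly p (x j)) = p"
  using assms degree_interpolant[OF assms(1)]
  by (intro poly_eq_on_nodes[of J x]) (auto simp: poly_interpolant)

section \<open>The differentiation matrix and the evaluation vector\<close>

text \<open>
  The matrix with entries \<open>L\<^sub>j'(\<tau>\<^sub>i)\<close>, for the Lagrange basis \<open>L\<close>, differentiates nodal values because
  every polynomial of degree less than \<open>s\<close> is its own interpolant. It is the only such matrix
  because the nodal vectors of the \<open>L\<^sub>j\<close> are the unit vectors.
\<close>

lemma diff_matrix_apply:
  assumes "s \<ge> 1" and inj: "inj_on (\<lambda>i. \<tau> $ i) {..<s}"
  shows "diff_matrix s \<tau> \<in> carrier_mat s s"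
    and "\<And>p i. degree p \<le> s - 1 \<Longrightarrow> i < s \<Longrightarrow>
      (\<Sum>j<s. diff_matrix s \<tau> $$ (i, j) * poly p (\<tau> $ j)) = poly (pderiv p) (\<tau> $ i)"
proof -
  let ?x = "\<lambda>i. \<tau> $ i"
  let ?L = "lagrange_basis {..<s} ?x"
  let ?D = "Matrix.mat s s (\<lambda>(i, j). poly (pderiv (?L j)) (?x i))"
  define P where "P D \<longleftrightarrow> D \<in> carrier_mat s s \<and>
     (\<forall>p. degree p \<le> s - 1 \<longrightarrow> D *\<^sub>v nodal_values s \<tau> p = nodal_values s \<tau> (pderiv p))" for D
  have apply_D: "(D *\<^sub>v nodal_values s \<tau> p) $ i = (\<Sum>j<s. D $$ (i, j) * poly p (?x j))"
    if "D \<in> carrier_mat s s" "i < s" for D p i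
    using that by (simp add: nodal_values_def scalar_prod_def lessThan_atLeast0)
  have "P ?D"
    unfolding P_def
  proof (intro conjI allI impI)
    fix p :: "real poly"
    assume p: "degree p \<le> s - 1"
    have "interpolant {..<s} ?x (\<lambda>j. poly p (?x j)) = p"
      using p assms by (intro interpolant_poly) (auto simp: lessThan_empty_iff)
    then have *: "p = (\<Sum>j<s. smult (poly p (?x j)) (?L j))"
      by (simp add: interpolant_def)
    have "pderiv p = (\<Sum>j<s. smult (poly p (?x j)) (pderiv (?L j)))"
      by (subst *) (simp add: higher_pderiv_sum[of 1, simplified] pderiv_smult)
    then have "(?D *\<^sub>v nodal_values s \<tau> p) $ i = poly (pderiv p) (?x i)" if "i < s" for i
      using that by (subst apply_D) (simp_all add: poly_sum mult_ac)
    then show "?D *\<^sub>v nodal_values s \<tau> p = nodal_values s \<tau> (pderiv p)"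
      by (intro eq_vecI) (simp_all add: nodal_values_def)
  qed auto
  moreover have "D = ?D" if "P D" for D
  proof (rule eq_matI)
    fix i j
    assume "i < dim_row ?D" "j < dim_col ?D"
    then have ij: "i < s" "j < s"
      by auto
    have "D *\<^sub>v nodal_values s \<tau> (?L j) = ?D *\<^sub>v nodal_values s \<tau> (?L j)"
      using \<open>P D\<close> \<open>P ?D\<close> ij degree_lagrange_basis[of "{..<s}" j ?x] by (simp add: P_def)
    then have "(D *\<^sub>v nodal_values s \<tau> (?L j)) $ i = (?D *\<^sub>v nodal_values s \<tau> (?L j)) $ i"
      by simp
    then have eq: "(\<Sum>k<s. D $$ (i, k) * poly (?L j) (?x k)) = (\<Sum>k<s. ?D $$ (i, k) * poly (?L j) (?x k))"
      using \<open>P D\<close> \<open>P ?D\<close> ij by (simp add: apply_D P_def del: index_mult_mat_vec)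
    have sel: "(\<Sum>k<s. E k * poly (?L j) (?x k)) = E j" for E
    proof -
      have "(\<Sum>k<s. E k * poly (?L j) (?x k)) = (\<Sum>k<s. if k = j then E k else 0)"
        using ij inj by (intro sum.cong) (auto simp: poly_lagrange_basis)
      then show ?thesis
        using ij by simp
    qed
    show "D $$ (i, j) = ?D $$ (i, j)"
      using eq unfolding sel .
  qed (use that in \<open>auto simp: P_def\<close>)
  ultimately have "P (diff_matrix s \<tau>)"
    unfolding diff_matrix_def P_def[symmetric] by (metis theI)
  then show "diff_matrix s \<tau> \<in> carrier_mat s s"
    by (simp add: P_def)
  show "(\<Sum>j<s. diff_matrix s \<tau> $$ (i, j) * poly p (\<tau> $ j)) = poly (pderiv p) (\<tau> $ i)"
    if "degree p \<le> s - 1" "i < s" for p i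
    using \<open>P (diff_matrix s \<tau>)\<close> that apply_D[of "diff_matrix s \<tau>" i p]
    by (simp add: P_def nodal_values_def del: index_mult_mat_vec)
qed

lemma eval_vec_apply:
  assumes "s \<ge> 1" and inj: "inj_on (\<lambda>i. \<tau> $ i) {..<s}"
  shows "eval_vec s \<tau> x \<in> carrier_vec s"
    and "\<And>p. degree p \<le> s - 1 \<Longrightarrow> (\<Sum>j<s. eval_vec s \<tau> x $ j * poly p (\<tau> $ j)) = poly p x"
proof -
  let ?x = "\<lambda>i. \<tau> $ i"
  let ?L = "lagrange_basis {..<s} ?x"
  let ?t = "Matrix.vec s (\<lambda>j. poly (?L j) x)"
  define P where "P t \<longleftrightarrow> t \<in> carrier_vec s \<and>
     (\<forall>p. degree p \<le> s - 1 \<longrightarrow> t \<bullet> nodal_values s \<tau> p = poly p x)" for t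
  have apply_t: "t \<bullet> nodal_values s \<tau> p = (\<Sum>j<s. t $ j * poly p (?x j))" for t p
    by (simp add: nodal_values_def scalar_prod_def lessThan_atLeast0)
  have "P ?t"
    unfolding P_def
  proof (intro conjI allI impI)
    fix p :: "real poly"
    assume p: "degree p \<le> s - 1"
    have "interpolant {..<s} ?x (\<lambda>j. poly p (?x j)) = p"
      using p assms by (intro interpolant_poly) (auto simp: lessThan_empty_iff)
    then have "poly p x = poly (\<Sum>j<s. smult (poly p (?x j)) (?L j)) x"
      by (simp add: interpolant_def)
    then show "?t \<bullet> nodal_values s \<tau> p = poly p x"
      by (simp add: apply_t poly_sum mult_ac)
  qed auto
  moreover have "t = ?t" if "P t" for t
  proof (rule eq_vecI)
    fix j
    assume "j < dim_vec ?t"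
    then have j: "j < s"
      by simp
    have "t \<bullet> nodal_values s \<tau> (?L j) = poly (?L j) x"
      using \<open>P t\<close> j degree_lagrange_basis[of "{..<s}" j ?x] by (simp add: P_def)
    moreover have "t \<bullet> nodal_values s \<tau> (?L j) = (\<Sum>k<s. if k = j then t $ k else 0)"
      unfolding apply_t using j inj by (intro sum.cong) (auto simp: poly_lagrange_basis)
    ultimately show "t $ j = ?t $ j"
      using j by simp
  qed (use that in \<open>auto simp: P_def\<close>)
  ultimately have "P (eval_vec s \<tau> x)"
    unfolding eval_vec_def P_def[symmetric] by (metis theI)
  then show "eval_vec s \<tau> x \<in> carrier_vec s"
    and "\<And>p. degree p \<le> s - 1 \<Longrightarrow> (\<Sum>j<s. eval_vec s \<tau> x $ j * poly p (\<tau> $ j)) = poly p x"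
    by (auto simp: P_def apply_t)
qed

section \<open>Quadratures as discrete integration by parts\<close>

lemma quadrature_nodes_inj:
  assumes "quadrature_on_unit_interval s c b"
  shows "inj_on (\<lambda>i. c $ i) {..<s}"
proof -
  have "c $ i \<noteq> c $ j" if "i < s" "j < s" "i \<noteq> j" for i j
    using assms that unfolding quadrature_on_unit_interval_def
    by (metis less_irrefl linorder_neqE_nat)
  then show ?thesis
    by (auto intro!: inj_onI)
qed

lemma quadrature_exact_mono: "quadrature_exact s c b m \<Longrightarrow> n \<le> m \<Longrightarrow> quadrature_exact s c b n"
  by (auto simp: quadrature_exact_def)

text \<open>
  The quadrature integrates the derivative of \<open>p q\<close> exactly, which has degree one less than \<open>p q\<close>.
\<close>

lemma quadrature_sbp:
  assumes "quadrature_exact s c b m" "degree (p * q) \<le> Suc m"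
  shows "(\<Sum>i<s. b $ i * (poly (pderiv p) (c $ i) * poly q (c $ i) + poly p (c $ i) * poly (pderiv q) (c $ i)))
    = poly p 1 * poly q 1 - poly p 0 * poly q 0"
proof -
  have "degree (pderiv (p * q)) \<le> m"
    using assms(2) by (simp add: degree_pderiv)
  then have "(\<Sum>i<s. b $ i * poly (pderiv (p * q)) (c $ i)) = integral {0..1} (poly (pderiv (p * q)))"
    using assms(1) unfolding quadrature_exact_def by blast
  also have "(poly (pderiv (p * q)) has_integral (poly (p * q) 1 - poly (p * q) 0)) {0..1}"
    by (intro fundamental_theorem_of_calculus)
      (auto simp flip: has_real_derivative_iff_has_vector_derivative simp del: poly_mult intro!: DERIV_subset[OF poly_DERIV])
  then have "integral {0..1} (poly (pderiv (p * q))) = poly (p * q) 1 - poly (p * q) 0"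
    by (rule integral_unique)
  finally show ?thesis
    by (simp add: pderiv_mult algebra_simps)
qed

text \<open>
  For such an \<open>h\<close> the quadrature sum reduces to \<open>b\<^sub>i h(c\<^sub>i)\<close>, while the integral of \<open>h\<close> is positive.
\<close>

lemma weight_nonzero:
  assumes "quadrature_exact s c b m" "i < s" "degree h \<le> m" "h \<noteq> 0"
    and nonneg: "\<And>x. 0 \<le> x \<Longrightarrow> x \<le> 1 \<Longrightarrow> 0 \<le> poly h x"
    and zeros: "\<And>j. j < s \<Longrightarrow> j \<noteq> i \<Longrightarrow> poly h (c $ j) = 0"
  shows "b $ i \<noteq> 0"
proof
  assume "b $ i = 0"
  then have "(\<Sum>j<s. b $ j * poly h (c $ j)) = 0"
    using zeros by (intro sum.neutral) auto
  then have "integral {0..1} (poly h) = 0"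
    using assms(1,3) by (simp add: quadrature_exact_def)
  then have "\<forall>x\<in>{0..1}. poly h x = 0"
    using nonneg by (subst (asm) integral_eq_0_iff) (auto intro!: continuous_intros)
  then have "{0..1} \<subseteq> {x. poly h x = 0}"
    by auto
  then have "finite {0..1::real}"
    using poly_roots_finite[OF \<open>h \<noteq> 0\<close>] finite_subset by blast
  then show False
    using infinite_Icc[of 0 "1::real"] by simp
qed

definition node_poly :: "real vec \<Rightarrow> nat set \<Rightarrow> real poly" where
  "node_poly c J = (\<Prod>j\<in>J. [:- c $ j, 1:])"

lemma node_poly_nonzero: "finite J \<Longrightarrow> node_poly c J \<noteq> 0"
  by (auto simp: node_poly_def)

lemma node_poly_root: "finite J \<Longrightarrow> j \<in> J \<Longrightarrow> poly (node_poly c J) (c $ j) = 0"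
  by (auto simp: node_poly_def poly_prod intro!: prod_zero)

lemma degree_node_poly:
  assumes "finite J"
  shows "degree (node_poly c J) \<le> card J"
  using degree_prod_sum_le[OF assms, of "\<lambda>j. [:- c $ j, 1:]"] assms
  by (simp add: node_poly_def o_def)

text \<open>
  The square of the node polynomial with \<open>c\<^sub>i\<close> left out has degree exactly \<open>2s - 2\<close>.
\<close>

lemma radau_weight_nonzero:
  assumes exact: "quadrature_exact s c b (2 * s - 2)" and i: "i < s"
  shows "b $ i \<noteq> 0"
proof (rule weight_nonzero[OF exact i])
  let ?g = "node_poly c ({..<s} - {i})"
  have "degree ?g \<le> s - 1"
    using degree_node_poly[of "{..<s} - {i}" c] i by simp
  then have "degree ?g * 2 \<le> 2 * s - 2"
    by linarith
  then show "degree (?g ^ 2) \<le> 2 * s - 2"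
    using degree_power_le[of ?g 2] by linarith
qed (auto simp: node_poly_nonzero node_poly_root)

text \<open>
  For exactness of degree \<open>2s - 3\<close> that square has one degree too many. If some other node \<open>c\<^sub>e\<close> is an
  end point of the interval, its factor \<open>\<bar>x - c\<^sub>e\<bar>\<close> is already nonnegative there and linear, and need not be squared.
\<close>

lemma weight_nonzero_linear_square:
  assumes exact: "quadrature_exact s c b (2 * s - 3)" and i: "i < s" and e: "e < s" "e \<noteq> i"
    and l: "l \<noteq> 0" "degree l \<le> 1" "poly l (c $ e) = 0"
    and nonneg: "\<And>x. 0 \<le> x \<Longrightarrow> x \<le> 1 \<Longrightarrow> 0 \<le> poly l x"
  shows "b $ i \<noteq> 0"
proof (rule weight_nonzero[OF exact i])
  let ?g = "node_poly c ({..<s} - {i, e})"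
  have "card ({..<s} - {i, e}) = s - 2"
    using i e by (subst card_Diff_subset) auto
  then have "degree ?g \<le> s - 2"
    using degree_node_poly[of "{..<s} - {i, e}" c] by simp
  then have "1 + degree ?g * 2 \<le> 2 * s - 3"
    using i e by linarith
  then show "degree (l * ?g ^ 2) \<le> 2 * s - 3"
    using degree_power_le[of ?g 2] degree_mult_le[of l "?g ^ 2"] l by linarith
  show "l * ?g ^ 2 \<noteq> 0"
    using l by (simp add: node_poly_nonzero)
  show "0 \<le> poly (l * ?g ^ 2) x" if "0 \<le> x" "x \<le> 1" for x
    using nonneg[OF that] by simp
  show "poly (l * ?g ^ 2) (c $ j) = 0" if "j < s" "j \<noteq> i" for j
    using that l by (cases "j = e") (auto simp: node_poly_root)
qed

lemma lobatto_weight_nonzero: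
  assumes "lobatto s c b" "s \<ge> 2" "i < s"
  shows "b $ i \<noteq> 0"
proof (cases "i = 0")
  case True
  show ?thesis
    by (rule weight_nonzero_linear_square[where e = "s - 1" and l = "[:1, - 1:]" and s = s and c = c])
      (use assms True in \<open>auto simp: lobatto_def\<close>)
next
  case False
  show ?thesis
    by (rule weight_nonzero_linear_square[where e = 0 and l = "[:0, 1:]" and s = s and c = c])
      (use assms False in \<open>auto simp: lobatto_def\<close>)
qed

section \<open>Inverse matrices\<close>

lemma inv_mat_inverse:
  assumes "A \<in> carrier_mat n n" "det A \<noteq> 0"
  shows "inv_mat A \<in> carrier_mat n n" "A * inv_mat A = 1\<^sub>m n" "inv_mat A * A = 1\<^sub>m n"
proof -
  have "mat_inverse A \<noteq> None"
    using mat_inverse(1)[OF assms(1), where b = "()"] det_non_zero_imp_unit[OF assms, where b = "()"] by blast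
  then obtain B where "mat_inverse A = Some B"
    by blast
  then show "inv_mat A \<in> carrier_mat n n" "A * inv_mat A = 1\<^sub>m n" "inv_mat A * A = 1\<^sub>m n"
    using mat_inverse(2)[OF assms(1)] by (auto simp: inv_mat_def)
qed

lemma inv_mat_diag:
  assumes "\<And>i. i < n \<Longrightarrow> d i \<noteq> 0"
  shows "inv_mat (mat_diag n d) = mat_diag n (\<lambda>i. 1 / d i)"
proof -
  let ?M = "mat_diag n d" and ?N = "mat_diag n (\<lambda>i. 1 / d i)"
  have M: "?M \<in> carrier_mat n n" and N: "?N \<in> carrier_mat n n"
    by auto
  have MN: "?M * ?N = 1\<^sub>m n"
    unfolding mat_diag_diag using assms by (intro eq_matI) (auto simp: mat_diag_def)
  then have "det ?M \<noteq> 0"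
    using det_mult[OF M N] by auto
  note inv = inv_mat_inverse[OF M this]
  have "inv_mat ?M = inv_mat ?M * (?M * ?N)"
    using inv(1) MN by simp
  also have "\<dots> = inv_mat ?M * ?M * ?N"
    using inv(1) M N by (simp add: assoc_mult_mat[of _ n n _ n _ n])
  finally show ?thesis
    using inv(3) N by simp
qed

section \<open>The Runge-Kutta method induced by the SBP SAT scheme\<close>

text \<open>
  The energy estimate behind the invertibility of \<open>D + M\<^sup>-\<^sup>1 t\<^sub>L t\<^sub>L\<^sup>T\<close>. A kernel element is the nodal
  vector of a polynomial \<open>p\<close>. Pairing the kernel equation with \<open>p\<close> in the discrete inner product
  gives \<open>\<integral> p' p + p(0)\<^sup>2 = 0\<close>, that is \<open>(p(1)\<^sup>2 + p(0)\<^sup>2) / 2 = 0\<close>. So \<open>p(0) = 0\<close>, the penalty term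
  disappears, and \<open>p'\<close> vanishes at more nodes than its degree allows.
\<close>

lemma sbp_sat_kernel_trivial:
  fixes c b :: "real vec"
  assumes s: "s \<ge> 1" and exact: "quadrature_exact s c b (2 * s - 3)"
    and inj: "inj_on (\<lambda>i. c $ i) {..<s}" and b: "\<forall>i<s. b $ i \<noteq> 0"
    and t: "\<And>p. degree p \<le> s - 1 \<Longrightarrow> (\<Sum>i<s. t i * poly p (c $ i)) = poly p 0"
    and deg_p: "degree p \<le> s - 1"
    and kernel: "\<And>i. i < s \<Longrightarrow> poly (pderiv p) (c $ i) + t i * poly p 0 / b $ i = 0"
  shows "p = 0"
proof -
  have "(\<Sum>i<s. b $ i * (poly (pderiv p) (c $ i) * poly p (c $ i))) + poly p 0 * (\<Sum>i<s. t i * poly p (c $ i))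
    = (\<Sum>i<s. b $ i * poly p (c $ i) * (poly (pderiv p) (c $ i) + t i * poly p 0 / b $ i))"
    unfolding sum_distrib_left sum.distrib[symmetric]
    using b by (intro sum.cong) (auto simp: field_simps)
  then have energy: "(\<Sum>i<s. b $ i * (poly (pderiv p) (c $ i) * poly p (c $ i))) + (poly p 0)\<^sup>2 = 0"
    using deg_p by (simp add: kernel t power2_eq_square)
  have "degree (p * p) \<le> Suc (2 * s - 3)"
    using degree_mult_le[of p p] deg_p s by linarith
  from quadrature_sbp[OF exact this]
  have "2 * (\<Sum>i<s. b $ i * (poly (pderiv p) (c $ i) * poly p (c $ i))) = (poly p 1)\<^sup>2 - (poly p 0)\<^sup>2"
    by (simp add: sum_distrib_left power2_eq_square algebra_simps)
  then have "(poly p 1)\<^sup>2 + (poly p 0)\<^sup>2 = 0"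
    using energy by linarith
  then have p0: "poly p 0 = 0"
    by simp
  have "poly (pderiv p) (c $ i) = 0" if "i < s" for i
    using kernel[OF that] p0 by simp
  moreover have "{..<s} \<noteq> {}"
    using s by (auto simp: lessThan_empty_iff)
  ultimately have "pderiv p = 0"
    using inj deg_p by (intro poly_eq_on_nodes[OF _ _ inj]) (auto simp: degree_pderiv)
  then obtain a where "p = [:a:]"
    by (metis degree_eq_zeroE pderiv_eq_0_iff)
  then show "p = 0"
    using p0 by simp
qed

text \<open>
  The Butcher matrix \<open>A\<close> as the inverse of the operator that sends a polynomial \<open>p\<close> to the values
  \<open>p'(c\<^sub>k) + t\<^sub>k p(0) / b\<^sub>k\<close>. The fourth conclusion says this for the left inverse, applied to arbitrary
  \<open>p\<close>; the last three say it for the right inverse, column by column, with \<open>P k\<close> the polynomial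
  through the entries of column \<open>k\<close>. Conditions on the rows of \<open>A\<close> follow from the former,
  conditions on its columns from the latter.
\<close>

lemma sbp_sat_rk_characterization:
  assumes T: "T > 0" and s: "s \<ge> 1"
    and quad: "quadrature_on_unit_interval s c b" and exact: "quadrature_exact s c b (2 * s - 3)"
    and b: "\<forall>i<s. b $ i \<noteq> 0"
    and A_def: "A = fst (sbp_sat_rk T s c b)"
    and t_def: "\<And>i. t i = eval_vec s (T \<cdot>\<^sub>v c) 0 $ i"
    and P_def: "\<And>k. P k = interpolant {..<s} (\<lambda>i. c $ i) (\<lambda>i. A $$ (i, k))"
  shows "sbp_sat_rk T s c b = (A, b, c)" and "A \<in> carrier_mat s s"
    and "\<And>p. degree p \<le> s - 1 \<Longrightarrow> (\<Sum>i<s. t i * poly p (c $ i)) = poly p 0"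
    and "\<And>p i. degree p \<le> s - 1 \<Longrightarrow> i < s \<Longrightarrow>
      (\<Sum>k<s. A $$ (i, k) * (poly (pderiv p) (c $ k) + t k * poly p 0 / b $ k)) = poly p (c $ i)"
    and "\<And>k. degree (P k) \<le> s - 1"
    and "\<And>i k. i < s \<Longrightarrow> k < s \<Longrightarrow> A $$ (i, k) = poly (P k) (c $ i)"
    and "\<And>i k. i < s \<Longrightarrow> k < s \<Longrightarrow>
      poly (pderiv (P k)) (c $ i) + t i * poly (P k) 0 / b $ i = (if i = k then 1 else 0)"
proof -
  let ?x = "\<lambda>i. c $ i"
  define \<tau> where "\<tau> = T \<cdot>\<^sub>v c"
  define M where "M = T \<cdot>\<^sub>m mat_diag s (\<lambda>i. b $ i)"
  define tL where "tL = eval_vec s \<tau> 0"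
  define D where "D = diff_matrix s \<tau>"
  define B where "B = D + inv_mat M * outer_product tL tL"
  have t: "t i = tL $ i" for i
    by (simp add: t_def tL_def \<tau>_def)
  have A_eq: "A = (1 / T) \<cdot>\<^sub>m inv_mat B"
    by (simp add: A_def sbp_sat_rk_def Let_def B_def D_def tL_def M_def \<tau>_def)
  have carr: "c \<in> carrier_vec s" "b \<in> carrier_vec s"
    using quad by (auto simp: quadrature_on_unit_interval_def)
  have \<tau>_nth: "\<tau> $ i = T * c $ i" if "i < s" for i
    using that carr by (simp add: \<tau>_def)
  note inj = quadrature_nodes_inj[OF quad]
  then have inj_\<tau>: "inj_on (\<lambda>i. \<tau> $ i) {..<s}"
    using T by (auto simp: inj_on_def \<tau>_nth)
  have D: "D \<in> carrier_mat s s" and tL: "tL \<in> carrier_vec s"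
    using diff_matrix_apply(1)[OF s inj_\<tau>] eval_vec_apply(1)[OF s inj_\<tau>] by (auto simp: D_def tL_def)
  \<comment> \<open>The substitution \<open>x \<mapsto> x / T\<close> carries polynomials on the nodes \<open>c\<close> to polynomials on the nodes \<open>T c\<close>.\<close>
  have scale: "degree (p \<circ>\<^sub>p [:0, 1 / T:]) \<le> s - 1"
      "\<And>x. poly (p \<circ>\<^sub>p [:0, 1 / T:]) (T * x) = poly p x"
      "\<And>x. poly (pderiv (p \<circ>\<^sub>p [:0, 1 / T:])) (T * x) = poly (pderiv p) x / T"
    if "degree p \<le> s - 1" for p
    using that T degree_pcompose_le[of p "[:0, 1 / T:]"]
    by (auto simp: poly_pcompose pderiv_pcompose pderiv_pCons)
  have D_apply: "(\<Sum>j<s. D $$ (i, j) * poly p (?x j)) = poly (pderiv p) (?x i) / T"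
    if "degree p \<le> s - 1" "i < s" for p i
    using diff_matrix_apply(2)[OF s inj_\<tau> scale(1)[OF that(1)] that(2)] that(2) scale[OF that(1)]
    by (simp add: D_def \<tau>_nth)
  have tL_apply: "(\<Sum>j<s. tL $ j * poly p (?x j)) = poly p 0" if "degree p \<le> s - 1" for p
    using eval_vec_apply(2)[OF s inj_\<tau> scale(1)[OF that], of 0] scale(2)[OF that, of 0] scale(2)[OF that]
    by (simp add: tL_def \<tau>_nth)
  have "M = mat_diag s (\<lambda>i. T * b $ i)"
    by (intro eq_matI) (auto simp: M_def mat_diag_def)
  then have inv_M: "inv_mat M = mat_diag s (\<lambda>i. 1 / (T * b $ i))"
    using T b by (simp add: inv_mat_diag)
  have outer: "outer_product tL tL \<in> carrier_mat s s"
    using tL by (auto simp: outer_product_def)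
  have B: "B \<in> carrier_mat s s"
    using D outer by (simp add: B_def inv_M mat_diag_mult_left)
  have B_nth: "B $$ (i, j) = D $$ (i, j) + tL $ i * tL $ j / (T * b $ i)" if "i < s" "j < s" for i j
    using that D outer tL by (simp add: B_def inv_M mat_diag_mult_left) (simp add: outer_product_def)
  have B_apply: "T * (\<Sum>j<s. B $$ (i, j) * poly p (?x j)) = poly (pderiv p) (?x i) + tL $ i * poly p 0 / b $ i"
    if "degree p \<le> s - 1" "i < s" for p i
  proof -
    have "(\<Sum>j<s. B $$ (i, j) * poly p (?x j))
      = (\<Sum>j<s. D $$ (i, j) * poly p (?x j)) + tL $ i / (T * b $ i) * (\<Sum>j<s. tL $ j * poly p (?x j))"
      using that unfolding sum_distrib_left sum.distrib[symmetric]
      by (intro sum.cong) (auto simp: B_nth algebra_simps)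
    then show ?thesis
      using that T by (simp add: D_apply tL_apply field_simps)
  qed
  have "det B \<noteq> 0"
  proof
    assume "det B = 0"
    then obtain v where v: "v \<in> carrier_vec s" "v \<noteq> 0\<^sub>v s" "B *\<^sub>v v = 0\<^sub>v s"
      using det_0_iff_vec_prod_zero_field[OF B] by blast
    define p where "p = interpolant {..<s} ?x (\<lambda>j. v $ j)"
    have deg_p: "degree p \<le> s - 1"
      using degree_interpolant[of "{..<s}" ?x] by (simp add: p_def)
    have p_nodes: "poly p (?x j) = v $ j" if "j < s" for j
      using inj that by (simp add: p_def poly_interpolant)
    have kernel: "poly (pderiv p) (?x i) + tL $ i * poly p 0 / b $ i = 0" if "i < s" for i
    proof -
      have "(\<Sum>j<s. B $$ (i, j) * poly p (?x j)) = (B *\<^sub>v v) $ i"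
        using that B v(1) by (simp add: scalar_prod_def lessThan_atLeast0 p_nodes)
      then show ?thesis
        using B_apply[OF deg_p that] v(3) that by simp
    qed
    have "p = 0"
      using sbp_sat_kernel_trivial[OF s exact inj b tL_apply deg_p kernel] .
    then have "v = 0\<^sub>v s"
      using v(1) p_nodes by (intro eq_vecI) auto
    then show False
      using v(2) by blast
  qed
  note inv = inv_mat_inverse[OF B this]
  have A: "A \<in> carrier_mat s s"
    using inv(1) by (simp add: A_eq)
  have "A * (T \<cdot>\<^sub>m B) = 1\<^sub>m s" "(T \<cdot>\<^sub>m B) * A = 1\<^sub>m s"
    using T B inv
    by (auto simp: A_eq mult_smult_distrib[of _ s s _ s] mult_smult_assoc_mat[of _ s s _ s] intro!: eq_matI)
  then have AB: "(\<Sum>k<s. A $$ (i, k) * (T * B $$ (k, j))) = (if i = j then 1 else 0)"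
    and BA: "(\<Sum>k<s. T * B $$ (i, k) * A $$ (k, j)) = (if i = j then 1 else 0)"
    if "i < s" "j < s" for i j
    using that A B by (auto simp: mat_eq_iff scalar_prod_def lessThan_atLeast0)
  have "(1 / T) \<cdot>\<^sub>v (M *\<^sub>v Matrix.vec s (\<lambda>_. 1)) = b"
    using carr T by (intro eq_vecI) (auto simp: M_def mat_diag_def scalar_prod_def if_distrib[of "(*) T"] cong: if_cong)
  moreover have "(1 / T) \<cdot>\<^sub>v \<tau> = c"
    using carr T by (intro eq_vecI) (auto simp: \<tau>_def)
  ultimately show "sbp_sat_rk T s c b = (A, b, c)"
    by (simp add: sbp_sat_rk_def Let_def A_eq B_def D_def tL_def M_def \<tau>_def)
  show "(\<Sum>k<s. A $$ (i, k) * (poly (pderiv p) (c $ k) + t k * poly p 0 / b $ k)) = poly p (c $ i)"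
    if "degree p \<le> s - 1" "i < s" for p i
  proof -
    have "(\<Sum>k<s. A $$ (i, k) * (poly (pderiv p) (c $ k) + t k * poly p 0 / b $ k))
      = (\<Sum>k<s. \<Sum>j<s. A $$ (i, k) * (T * B $$ (k, j)) * poly p (?x j))"
      using that by (intro sum.cong) (auto simp: B_apply[symmetric] t sum_distrib_left mult_ac)
    also have "\<dots> = (\<Sum>j<s. (\<Sum>k<s. A $$ (i, k) * (T * B $$ (k, j))) * poly p (?x j))"
      unfolding sum_distrib_right by (rule sum.swap)
    also have "\<dots> = (\<Sum>j<s. if j = i then poly p (?x j) else 0)"
      using that by (intro sum.cong) (auto simp: AB)
    finally show ?thesis
      using that by simp
  qed
  show deg_P: "degree (P k) \<le> s - 1" for k
    using degree_interpolant[of "{..<s}" ?x] by (simp add: P_def)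
  show P_nodes: "A $$ (i, k) = poly (P k) (c $ i)" if "i < s" "k < s" for i k
    using inj that by (simp add: P_def poly_interpolant)
  show "poly (pderiv (P k)) (c $ i) + t i * poly (P k) 0 / b $ i = (if i = k then 1 else 0)"
    if "i < s" "k < s" for i k
  proof -
    have "T * (\<Sum>j<s. B $$ (i, j) * poly (P k) (c $ j)) = (if i = k then 1 else 0)"
      using BA[OF that] that by (simp add: P_nodes[symmetric] sum_distrib_left mult_ac)
    then show ?thesis
      using B_apply[OF deg_P that(1)] by (simp add: t)
  qed
  show "A \<in> carrier_mat s s"
    by (rule A)
  show "(\<Sum>i<s. t i * poly p (c $ i)) = poly p 0" if "degree p \<le> s - 1" for p
    using tL_apply[OF that] by (simp add: t)
qed

section \<open>Uniqueness of the classical coefficients\<close>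

lemma simplifying_C_moment:
  assumes "simplifying_C s A c \<eta>" "i < s" "k < \<eta>"
  shows "(\<Sum>j<s. A $$ (i, j) * c $ j ^ k) = 1 / real (Suc k) * c $ i ^ Suc k"
  using assms(1)[unfolded simplifying_C_def, rule_format, of i "Suc k"] assms(2,3)
  by (simp del: power_Suc)

lemma simplifying_D_moment:
  assumes "simplifying_D s A b c \<zeta>" "j < s" "k < \<zeta>"
  shows "(\<Sum>i<s. b $ i * A $$ (i, j) * c $ i ^ k) = 1 / real (Suc k) * b $ j * (1 - c $ j ^ Suc k)"
  using assms(1)[unfolded simplifying_D_def, rule_format, of j "Suc k"] assms(2,3)
  by (simp add: mult_ac del: power_Suc)

lemma simplifying_C_unique:
  assumes inj: "inj_on (\<lambda>i. c $ i) {..<s}" and A: "A \<in> carrier_mat s s" "simplifying_C s A c s"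
    and A': "A' \<in> carrier_mat s s" "simplifying_C s A' c s"
  shows "A' = A"
proof (rule eq_matI)
  fix i j
  assume "i < dim_row A" "j < dim_col A"
  then have ij: "i < s" "j < s"
    using A by auto
  have "(\<Sum>j<s. A' $$ (i, j) * c $ j ^ k) = (\<Sum>j<s. A $$ (i, j) * c $ j ^ k)" if "k < s" for k
    using simplifying_C_moment[OF A(2) ij(1) that] simplifying_C_moment[OF A'(2) ij(1) that] by (simp only:)
  then show "A' $$ (i, j) = A $$ (i, j)"
    using inj ij
    by (intro moments_determine_weights[where J = "{..<s}" and x = "\<lambda>j. c $ j"
          and u = "\<lambda>j. A' $$ (i, j)" and v = "\<lambda>j. A $$ (i, j)"]) auto
qed (use A A' in auto)

lemma simplifying_D_unique:
  assumes inj: "inj_on (\<lambda>i. c $ i) {..<s}" and b: "\<forall>i<s. b $ i \<noteq> 0"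
    and A: "A \<in> carrier_mat s s" "simplifying_D s A b c s"
    and A': "A' \<in> carrier_mat s s" "simplifying_D s A' b c s"
  shows "A' = A"
proof (rule eq_matI)
  fix i j
  assume "i < dim_row A" "j < dim_col A"
  then have ij: "i < s" "j < s"
    using A by auto
  have "(\<Sum>i<s. b $ i * A' $$ (i, j) * c $ i ^ k) = (\<Sum>i<s. b $ i * A $$ (i, j) * c $ i ^ k)"
    if "k < s" for k
    using simplifying_D_moment[OF A(2) ij(2) that] simplifying_D_moment[OF A'(2) ij(2) that] by (simp only:)
  then have "b $ i * A' $$ (i, j) = b $ i * A $$ (i, j)"
    using inj ij
    by (intro moments_determine_weights[where J = "{..<s}" and x = "\<lambda>i. c $ i"
          and u = "\<lambda>i. b $ i * A' $$ (i, j)" and v = "\<lambda>i. b $ i * A $$ (i, j)"]) auto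
  then show "A' $$ (i, j) = A $$ (i, j)"
    using b ij(1) by simp
qed (use A A' in auto)

text \<open>
  With the first column given, each row has \<open>s - 1\<close> unknown entries, which are the weights at the
  nodes other than the first one; \<open>C(s - 1)\<close> prescribes just as many moments of them.
\<close>

lemma simplifying_C_first_column_unique:
  assumes inj: "inj_on (\<lambda>i. c $ i) {..<s}" and s: "s \<ge> 1"
    and A: "A \<in> carrier_mat s s" "simplifying_C s A c (s - 1)" "\<And>i. i < s \<Longrightarrow> A $$ (i, 0) = \<beta>"
    and A': "A' \<in> carrier_mat s s" "simplifying_C s A' c (s - 1)" "\<And>i. i < s \<Longrightarrow> A' $$ (i, 0) = \<beta>"
  shows "A' = A"
proof (rule eq_matI)
  fix i j
  assume "i < dim_row A" "j < dim_col A"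
  then have ij: "i < s" "j < s"
    using A by auto
  have "{..<s} = insert 0 {1..<s}"
    using s by auto
  then have split: "(\<Sum>j<s. f j) = f 0 + (\<Sum>j\<in>{1..<s}. f j)" for f :: "nat \<Rightarrow> real"
    by simp
  have inj': "inj_on (\<lambda>i. c $ i) {1..<s}"
    by (rule inj_on_subset[OF inj]) auto
  have "(\<Sum>j\<in>{1..<s}. A' $$ (i, j) * c $ j ^ k) = (\<Sum>j\<in>{1..<s}. A $$ (i, j) * c $ j ^ k)"
    if "k < card {1..<s}" for k
  proof -
    have "k < s - 1"
      using that by simp
    then have "(\<Sum>j<s. A' $$ (i, j) * c $ j ^ k) = (\<Sum>j<s. A $$ (i, j) * c $ j ^ k)"
      using simplifying_C_moment[OF A(2) ij(1)] simplifying_C_moment[OF A'(2) ij(1)] by (simp only:)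
    then show ?thesis
      using A(3) A'(3) ij by (simp add: split)
  qed
  then have "A' $$ (i, j) = A $$ (i, j)" if "j \<noteq> 0"
    using inj' ij that
    by (intro moments_determine_weights[where J = "{1..<s}" and x = "\<lambda>j. c $ j"
          and u = "\<lambda>j. A' $$ (i, j)" and v = "\<lambda>j. A $$ (i, j)"]) auto
  then show "A' $$ (i, j) = A $$ (i, j)"
    using A(3) A'(3) ij by (cases "j = 0") auto
qed (use A A' in auto)

section \<open>Identification with the classical methods\<close>

text \<open>
  The monomial \<open>x\<^sup>q / q\<close> is annihilated by evaluation at \<open>0\<close>, so the penalty term drops out and the
  inverse relation for it is the condition \<open>C(q)\<close> itself.
\<close>

lemma sbp_sat_simplifying_C:
  assumes inverse: "\<And>p i. degree p \<le> s - 1 \<Longrightarrow> i < s \<Longrightarrow>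
      (\<Sum>k<s. A $$ (i, k) * (poly (pderiv p) (c $ k) + t k * poly p 0 / b $ k)) = poly p (c $ i)"
  shows "simplifying_C s A c (s - 1)"
  unfolding simplifying_C_def
proof (intro allI impI ballI)
  fix i q
  assume i: "i < s" and q: "q \<in> {1..s - 1}"
  let ?p = "monom (1 / real q) q"
  have "degree ?p \<le> s - 1"
    using q degree_monom_le[of "1 / real q" q] by auto
  from inverse[OF this i] show "(\<Sum>j<s. A $$ (i, j) * c $ j ^ (q - 1)) = 1 / real q * c $ i ^ q"
    using q by (simp add: poly_monom pderiv_monom power_0_left)
qed

text \<open>
  When the evaluation point is a node, the evaluation vector is a unit vector; this is how the
  condition \<open>c\<^sub>1 = 0\<close> enters for left Radau and Lobatto nodes.
\<close>

lemma evaluation_at_node_weights: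
  fixes c :: "real vec"
  assumes inj: "inj_on (\<lambda>i. c $ i) {..<s}" and k: "k < s" and i: "i < s"
    and t: "\<And>p. degree p \<le> s - 1 \<Longrightarrow> (\<Sum>i<s. t i * poly p (c $ i)) = poly p (c $ k)"
  shows "t i = (if i = k then 1 else 0)"
proof -
  let ?L = "lagrange_basis {..<s} (\<lambda>i. c $ i) i"
  have "t i = (\<Sum>j<s. if j = i then t j else 0)"
    using i by simp
  also have "\<dots> = (\<Sum>j<s. t j * poly ?L (c $ j))"
    using i inj by (intro sum.cong) (auto simp: poly_lagrange_basis)
  also have "\<dots> = poly ?L (c $ k)"
    using t[of ?L] degree_lagrange_basis[of "{..<s}" i] i by simp
  finally show ?thesis
    using i k inj by (auto simp: poly_lagrange_basis)
qed

lemma sbp_left_radau_is_radau_IA: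
  assumes "T > 0" "s \<ge> 1" "left_radau s c b"
  shows "sbp_sat_rk T s c b = radau_IA s c b"
proof -
  have quad: "quadrature_on_unit_interval s c b" and c0: "c $ 0 = 0"
    and exact: "quadrature_exact s c b (2 * s - 2)"
    using assms by (auto simp: left_radau_def)
  have exact': "quadrature_exact s c b (2 * s - 3)"
    using exact by (rule quadrature_exact_mono) simp
  have b: "\<forall>i<s. b $ i \<noteq> 0"
    using radau_weight_nonzero[OF exact] by blast
  note inj = quadrature_nodes_inj[OF quad]
  define A where "A = fst (sbp_sat_rk T s c b)"
  define t where "t i = eval_vec s (T \<cdot>\<^sub>v c) 0 $ i" for i
  define P where "P k = interpolant {..<s} (\<lambda>i. c $ i) (\<lambda>i. A $$ (i, k))" for k
  note sbp = sbp_sat_rk_characterization[OF assms(1,2) quad exact' b A_def t_def P_def]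
  note eq = sbp(1) and A = sbp(2) and t = sbp(3) and deg = sbp(5) and P = sbp(6) and kron = sbp(7)
  have t_unit: "t i = (if i = 0 then 1 else 0)" if "i < s" for i
    using evaluation_at_node_weights[OF inj _ that, of 0 t] t c0 that by simp
  have "simplifying_D s A b c s"
    unfolding simplifying_D_def
  proof (intro allI impI ballI)
    fix k q
    assume k: "k < s" and q: "q \<in> {1..s}"
    have "q \<le> s"
      using q by simp
    \<comment> \<open>The factor \<open>(1 - x\<^sup>q) / q\<close> has derivative \<open>- x\<^sup>q\<^sup>-\<^sup>1\<close> and no boundary term at \<open>1\<close>.\<close>
    define g where "g = smult (1 / real q) (1 - monom 1 q)"
    have g: "poly g x = 1 / real q * (1 - x ^ q)" "poly (pderiv g) x = - (x ^ (q - 1))" for x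
      using q by (auto simp: g_def poly_monom pderiv_smult pderiv_diff pderiv_monom)
    have "degree g \<le> q"
      unfolding g_def by (intro degree_smult_le[THEN order_trans] degree_diff_le) (auto simp: degree_monom_le)
    then have "degree (g * P k) \<le> Suc (2 * s - 2)"
      using degree_mult_le[of g "P k"] deg[of k] assms(2) \<open>q \<le> s\<close> by linarith
    from quadrature_sbp[OF exact this]
    have by_parts: "(\<Sum>i<s. b $ i * (poly g (c $ i) * poly (pderiv (P k)) (c $ i)))
      = (\<Sum>i<s. b $ i * c $ i ^ (q - 1) * poly (P k) (c $ i)) - poly g 0 * poly (P k) 0"
      using q by (simp add: g algebra_simps sum.distrib sum_subtractf)
    have "b $ k * poly g (c $ k) = (\<Sum>i<s. if i = k then b $ i * poly g (c $ i) else 0)"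
      using k by simp
    also have "\<dots> = (\<Sum>i<s. b $ i * poly g (c $ i) * (poly (pderiv (P k)) (c $ i) + t i * poly (P k) 0 / b $ i))"
      using k kron by (intro sum.cong) auto
    also have "\<dots> = (\<Sum>i<s. b $ i * (poly g (c $ i) * poly (pderiv (P k)) (c $ i))
        + (if i = 0 then poly g (c $ i) * poly (P k) 0 else 0))"
      using b by (intro sum.cong) (auto simp: t_unit field_simps)
    \<comment> \<open>The penalty contributes \<open>g(0) P\<^sub>k(0)\<close>, which cancels the boundary term at \<open>0\<close>.\<close>
    also have "\<dots> = (\<Sum>i<s. b $ i * c $ i ^ (q - 1) * poly (P k) (c $ i))"
      using assms(2) by (simp add: sum.distrib by_parts c0)
    finally show "(\<Sum>i<s. b $ i * c $ i ^ (q - 1) * A $$ (i, k)) = 1 / real q * b $ k * (1 - c $ k ^ q)"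
      using k by (simp add: P g)
  qed
  then have "(THE A. A \<in> carrier_mat s s \<and> simplifying_D s A b c s) = A"
    using A by (intro the_equality) (auto intro: simplifying_D_unique[OF inj b])
  then show ?thesis
    by (simp add: eq radau_IA_def)
qed

lemma sbp_right_radau_is_radau_IIA:
  assumes "T > 0" "s \<ge> 1" "right_radau s c b"
  shows "sbp_sat_rk T s c b = radau_IIA s c b"
proof -
  have quad: "quadrature_on_unit_interval s c b" and c1: "c $ (s - 1) = 1"
    and exact: "quadrature_exact s c b (2 * s - 2)"
    using assms by (auto simp: right_radau_def)
  have exact': "quadrature_exact s c b (2 * s - 3)"
    using exact by (rule quadrature_exact_mono) simp
  have b: "\<forall>i<s. b $ i \<noteq> 0"
    using radau_weight_nonzero[OF exact] by blast
  note inj = quadrature_nodes_inj[OF quad]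
  define A where "A = fst (sbp_sat_rk T s c b)"
  define t where "t i = eval_vec s (T \<cdot>\<^sub>v c) 0 $ i" for i
  note sbp = sbp_sat_rk_characterization[OF assms(1,2) quad exact' b A_def t_def refl]
  note eq = sbp(1) and A = sbp(2) and t = sbp(3) and inverse = sbp(4)
  define p where "p = interpolant {..<s} (\<lambda>i. c $ i) (\<lambda>i. c $ i ^ s)"
  define \<omega> where "\<omega> = monom 1 s - p"
  have deg_p: "degree p \<le> s - 1"
    using degree_interpolant[of "{..<s}" "\<lambda>i. c $ i"] by (simp add: p_def)
  have p_nodes: "poly p (c $ i) = c $ i ^ s" if "i < s" for i
    using inj that by (simp add: p_def poly_interpolant)
  have \<omega>: "poly \<omega> (c $ i) = 0" if "i < s" for i
    using that by (simp add: \<omega>_def poly_monom p_nodes)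
  have "poly \<omega> 1 = 0"
    using \<omega>[of "s - 1"] c1 assms(2) by simp
  have "degree \<omega> \<le> s"
    using deg_p by (auto simp: \<omega>_def degree_monom_le intro!: degree_diff_le)
  \<comment> \<open>Integration by parts leaves no moments of the defect, since \<open>\<omega>\<close> is zero at the nodes, in particular at \<open>1\<close>.\<close>
  have defect: "b $ i * poly (pderiv \<omega>) (c $ i) + t i * poly \<omega> 0 = 0" if "i < s" for i
  proof (rule moments_determine_weights[where J = "{..<s}" and x = "\<lambda>i. c $ i"
        and u = "\<lambda>i. b $ i * poly (pderiv \<omega>) (c $ i) + t i * poly \<omega> 0" and v = "\<lambda>_. 0"])
    fix k
    assume "k < card {..<s}"
    then have k: "k < s"
      by simp
    let ?q = "monom 1 k :: real poly"
    have deg_q: "degree ?q \<le> s - 1"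
      using degree_monom_le[of "1::real" k] k by linarith
    then have "degree (\<omega> * ?q) \<le> Suc (2 * s - 2)"
      using degree_mult_le[of \<omega> ?q] \<open>degree \<omega> \<le> s\<close> assms(2) by linarith
    from quadrature_sbp[OF exact this]
    have "(\<Sum>i<s. b $ i * (poly (pderiv \<omega>) (c $ i) * poly ?q (c $ i))) = - (poly \<omega> 0 * poly ?q 0)"
      using \<open>poly \<omega> 1 = 0\<close> by (simp add: \<omega>)
    moreover have "(\<Sum>i<s. (b $ i * poly (pderiv \<omega>) (c $ i) + t i * poly \<omega> 0) * c $ i ^ k)
      = (\<Sum>i<s. b $ i * (poly (pderiv \<omega>) (c $ i) * poly ?q (c $ i))) + poly \<omega> 0 * (\<Sum>i<s. t i * poly ?q (c $ i))"
      by (simp add: poly_monom algebra_simps sum.distrib sum_distrib_left)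
    ultimately show "(\<Sum>i<s. (b $ i * poly (pderiv \<omega>) (c $ i) + t i * poly \<omega> 0) * c $ i ^ k) = (\<Sum>i<s. 0 * c $ i ^ k)"
      using t[OF deg_q] by simp
  qed (use that inj in auto)
  \<comment> \<open>The defect of \<open>\<omega>\<close> being zero, the scheme treats the interpolant \<open>p = x\<^sup>s - \<omega>\<close> as it would \<open>x\<^sup>s\<close> itself.\<close>
  have derivative: "poly (pderiv p) (c $ k) + t k * poly p 0 / b $ k = real s * c $ k ^ (s - 1)" if "k < s" for k
  proof -
    have "poly p 0 = - poly \<omega> 0"
      using assms(2) by (simp add: \<omega>_def poly_monom power_0_left)
    moreover have "poly (pderiv p) (c $ k) = real s * c $ k ^ (s - 1) - poly (pderiv \<omega>) (c $ k)"
      by (simp add: \<omega>_def pderiv_diff pderiv_monom poly_monom)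
    moreover have "poly (pderiv \<omega>) (c $ k) = - (t k * poly \<omega> 0 / b $ k)"
      using defect[OF that] b that by (simp add: field_simps)
    ultimately show ?thesis
      by simp
  qed
  have "simplifying_C s A c s"
    unfolding simplifying_C_def
  proof (intro allI impI ballI)
    fix i q
    assume i: "i < s" and q: "q \<in> {1..s}"
    show "(\<Sum>j<s. A $$ (i, j) * c $ j ^ (q - 1)) = 1 / real q * c $ i ^ q"
    proof (cases "q = s")
      case True
      have "real s * (\<Sum>j<s. A $$ (i, j) * c $ j ^ (s - 1)) = c $ i ^ s"
        using inverse[OF deg_p i] by (simp add: derivative p_nodes i sum_distrib_left mult_ac)
      then show ?thesis
        using assms(2) True by (simp add: field_simps)
    next
      case False
      then have "q \<in> {1..s - 1}"
        using q by auto
      then show ?thesis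
        using sbp_sat_simplifying_C[of s A c t b, OF inverse] i unfolding simplifying_C_def by blast
    qed
  qed
  then have "(THE A. A \<in> carrier_mat s s \<and> simplifying_C s A c s) = A"
    using A by (intro the_equality) (auto intro: simplifying_C_unique[OF inj])
  then show ?thesis
    by (simp add: eq radau_IIA_def)
qed

lemma sbp_lobatto_is_lobatto_IIIC:
  assumes "T > 0" "s \<ge> 2" "lobatto s c b"
  shows "sbp_sat_rk T s c b = lobatto_IIIC s c b"
proof -
  have quad: "quadrature_on_unit_interval s c b" and c0: "c $ 0 = 0"
    and exact: "quadrature_exact s c b (2 * s - 3)"
    using assms by (auto simp: lobatto_def)
  have s: "s \<ge> 1"
    using assms(2) by simp
  have b: "\<forall>i<s. b $ i \<noteq> 0"
    using lobatto_weight_nonzero[OF assms(3,2)] by blast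
  note inj = quadrature_nodes_inj[OF quad]
  define A where "A = fst (sbp_sat_rk T s c b)"
  define t where "t i = eval_vec s (T \<cdot>\<^sub>v c) 0 $ i" for i
  note sbp = sbp_sat_rk_characterization[OF assms(1) s quad exact b A_def t_def refl]
  note eq = sbp(1) and A = sbp(2) and t = sbp(3) and inverse = sbp(4)
  have t_unit: "t i = (if i = 0 then 1 else 0)" if "i < s" for i
    using evaluation_at_node_weights[OF inj _ that, of 0 t] t c0 that by simp
  have column: "A $$ (i, 0) = b $ 0" if "i < s" for i
  proof -
    have "1 = (\<Sum>k<s. A $$ (i, k) * (t k / b $ k))"
      using inverse[of 1 i] that by simp
    also have "\<dots> = (\<Sum>k<s. if k = 0 then A $$ (i, k) / b $ k else 0)"
      by (intro sum.cong) (auto simp: t_unit)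
    finally show ?thesis
      using b s by (simp add: field_simps)
  qed
  have "(THE A. A \<in> carrier_mat s s \<and> simplifying_C s A c (s - 1) \<and> (\<forall>i<s. A $$ (i, 0) = b $ 0)) = A"
    using A column sbp_sat_simplifying_C[of s A c t b, OF inverse]
    by (intro the_equality) (auto intro!: simplifying_C_first_column_unique[OF inj s, where \<beta> = "b $ 0"])
  then show ?thesis
    by (simp add: eq lobatto_IIIC_def)
qed

theorem theorem3p1:
  fixes T :: real and s :: nat and c b :: "real vec"
  assumes "T > 0"
  shows "(s \<ge> 1 \<and> left_radau s c b \<longrightarrow> sbp_sat_rk T s c b = radau_IA s c b) \<and>
         (s \<ge> 1 \<and> right_radau s c b \<longrightarrow> sbp_sat_rk T s c b = radau_IIA s c b) \<and>
         (s \<ge> 2 \<and> lobatto s c b \<longrightarrow> sbp_sat_rk T s c b = lobatto_IIIC s c b)"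
  using assms sbp_left_radau_is_radau_IA sbp_right_radau_is_radau_IIA sbp_lobatto_is_lobatto_IIIC by blast

end
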